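(* Let $L$ be a complete lowly finite distributive lattice, and let $M$ be a subset of $L$ such that $\mathrm{ji}(L) \subseteq M$. If $a \in M \setminus \mathrm{ji}(L)$, then $$u_M(a) = \sum_{b \in M,\ b \preceq a} \mu_M(b,a)\, b \ \in\ \mathrm{N}(L).$$
   Context: A poset is complete if it has a greatest element $\mathsf{1}$ and a lowest element $\mathsf{0}$. A poset $L$ is lowly finite if $\{b \in L \mid b \preceq a\}$ is finite for every $a \in L$. An element $a$ of a lattice $L$ is join-irreducible if, for any nonempty subset $S \subseteq L$, $a = \bigvee_{b \in S} b$ implies $a \in S$; $\mathrm{ji}(L)$ denotes the set of join-irreducible elements of $L$ (with this convention $\mathsf{0} \in \mathrm{ji}(L)$). The subset $M$ is a poset under the order induced from $L$, and $\mu_M$ denotes its Möbius function: $\mu_M(a,a)=1$ and $\mu_M(a,b) = -\sum_{c \in M,\, a \preceq c \prec b} \mu_M(a,c)$ for $a \prec b$ in $M$. $\mathbb{Z}L$ is the free $\mathbb{Z}$-module with basis $L$, and $\mathrm{N}(L)$ is the submodule of $\mathbb{Z}L$ generated by all elements $a \wedge b + a \vee b - a - b$ with $a,b \in L$. *)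

theory Defs
  imports Main "HOL-Library.Poly_Mapping" "HOL-Library.Lub_Glb"
begin

definition lowly_finite :: "'a::order itself \<Rightarrow> bool"
  where "lowly_finite _ \<longleftrightarrow> (\<forall>a::'a. finite {b. b \<le> a})"

text \<open>Only nonempty \<^term>\<open>S\<close> are tested, so a least element is join-irreducible.
  \<^term>\<open>isLub UNIV S a\<close> says that the join of \<^term>\<open>S\<close> exists and equals \<^term>\<open>a\<close>.\<close>

definition join_irreducible :: "'a::lattice \<Rightarrow> bool"
  where "join_irreducible a \<longleftrightarrow> (\<forall>S. S \<noteq> {} \<and> isLub UNIV S a \<longrightarrow> a \<in> S)"

definition ji :: "'a::lattice set"
  where "ji = {a. join_irreducible a}"

text \<open>The recursion is well-founded only if the interval from \<^term>\<open>a\<close> to \<^term>\<open>b\<close> in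
  \<^term>\<open>M\<close> is finite. When it is infinite, when \<^term>\<open>a \<le> b\<close> fails, or when \<^term>\<open>a\<close> or
  \<^term>\<open>b\<close> is outside \<^term>\<open>M\<close>, the value is set to 0.\<close>

function mobius :: "'a::order set \<Rightarrow> 'a \<Rightarrow> 'a \<Rightarrow> int"
  where
    "mobius M a b =
      (if a \<in> M \<and> b \<in> M \<and> finite {c \<in> M. a \<le> c \<and> c \<le> b} then
         if a = b then 1
         else if a < b then - (\<Sum>c \<in> {c \<in> M. a \<le> c \<and> c < b}. mobius M a c)
         else 0
       else 0)"
  by auto
termination
proof (relation "Wellfounded.measure (\<lambda>(M, a, b). card {c \<in> M. a \<le> c \<and> c \<le> b})")
  show "wf (Wellfounded.measure (\<lambda>(M, a, b). card {c \<in> M. a \<le> c \<and> c \<le> b}))"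
    by simp
next
  fix M :: "'a set" and a b c
  assume M: "a \<in> M \<and> b \<in> M \<and> finite {c \<in> M. a \<le> c \<and> c \<le> b}"
    and "a < b" and c: "c \<in> {c \<in> M. a \<le> c \<and> c < b}"
  have "b \<in> {d \<in> M. a \<le> d \<and> d \<le> b} - {d \<in> M. a \<le> d \<and> d \<le> c}"
    using M c \<open>a < b\<close> by auto
  moreover have "{d \<in> M. a \<le> d \<and> d \<le> c} \<subseteq> {d \<in> M. a \<le> d \<and> d \<le> b}"
    using c by auto
  ultimately have "{d \<in> M. a \<le> d \<and> d \<le> c} \<subset> {d \<in> M. a \<le> d \<and> d \<le> b}"
    by blast
  then show "((M, a, c), (M, a, b)) \<in>
      Wellfounded.measure (\<lambda>(M, a, b). card {c \<in> M. a \<le> c \<and> c \<le> b})"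
    using M by (simp add: psubset_card_mono)
qed

declare mobius.simps [simp del]

text \<open>The free abelian group on the lattice is the type \<^typ>\<open>'a \<Rightarrow>\<^sub>0 int\<close>, with basis elements
  \<^term>\<open>frag_of a\<close>. The next interpretation makes its \<^term>\<open>module.span\<close> available.\<close>

interpretation frag: module "frag_cmul :: int \<Rightarrow> ('a \<Rightarrow>\<^sub>0 int) \<Rightarrow> ('a \<Rightarrow>\<^sub>0 int)"
  by standard (simp_all add: frag_cmul_distrib frag_cmul_distrib2)

definition N_submodule :: "('a::lattice \<Rightarrow>\<^sub>0 int) set"
  where "N_submodule =
    frag.span {frag_of (inf a b) + frag_of (sup a b) - frag_of a - frag_of b | a b. True}"

definition u_elem :: "'a::order set \<Rightarrow> 'a \<Rightarrow> ('a \<Rightarrow>\<^sub>0 int)"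
  where "u_elem M a = (\<Sum>b \<in> {b \<in> M. b \<le> a}. frag_cmul (mobius M b a) (frag_of b))"

end

theory Submission
  imports Defs
begin

text \<open>Modulo \<^term>\<open>N_submodule\<close> every lattice element \<open>x\<close> is the sum, over the join-irreducible
  \<open>j \<le> x\<close>, of classes that depend on \<open>j\<close> only. These classes are those of \<^term>\<open>u_elem ji j\<close>: for
  join-irreducible \<open>x\<close> the decomposition is Moebius inversion on \<^term>\<open>ji\<close>
  (\<open>sum_u_elem\<close>). Any other \<open>x\<close> is a join of two smaller elements \<open>y\<close> and \<open>z\<close>, so
  \<open>x \<equiv> y + z - inf y z\<close>; since join-irreducible elements of a distributive lattice are join-prime, the
  join-irreducibles below \<open>x\<close> are those below \<open>y\<close> or below \<open>z\<close>, and inclusion--exclusion carries the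
  decomposition from \<open>y\<close>, \<open>z\<close> and \<open>inf y z\<close> to \<open>x\<close> (\<open>frag_of_cong_sum_u_elem_ji\<close>).

  Substituting this decomposition into \<^term>\<open>u_elem M a\<close>, the coefficient of \<^term>\<open>u_elem ji j\<close>
  becomes the sum of \<^term>\<open>mobius M b a\<close> over \<open>b \<in> M\<close> with \<open>j \<le> b \<le> a\<close>. As
  \<^term>\<open>ji \<subseteq> M\<close>, the lower end \<open>j\<close> of this interval belongs to \<open>M\<close>, and \<open>j \<noteq> a\<close> because \<open>a\<close> is not
  join-irreducible. Hence every coefficient vanishes (\<open>mobius_sum_left\<close>).\<close>

section \<open>Moebius functions of locally finite posets\<close>

lemma mobius_self:
  assumes "a \<in> M"
  shows "mobius M a a = 1"
proof -
  have "{c \<in> M. a \<le> c \<and> c \<le> a} = {a}"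
    using assms by auto
  then show ?thesis
    using assms by (simp add: mobius.simps)
qed

lemma mobius_sum_right:
  assumes "a \<in> M" "b \<in> M" "a \<le> b" and fin: "finite {c \<in> M. a \<le> c \<and> c \<le> b}"
  shows "(\<Sum>c | c \<in> M \<and> a \<le> c \<and> c \<le> b. mobius M a c) = (if a = b then 1 else 0)"
proof (cases "a = b")
  case True
  have "{c \<in> M. b \<le> c \<and> c \<le> b} = {b}"
    using assms by auto
  then show ?thesis
    using True assms by (simp add: mobius_self)
next
  case False
  have split: "{c \<in> M. a \<le> c \<and> c \<le> b} = insert b {c \<in> M. a \<le> c \<and> c < b}"
    using assms False by auto
  have "mobius M a b = - (\<Sum>c \<in> {c \<in> M. a \<le> c \<and> c < b}. mobius M a c)"
    using assms False by (subst mobius.simps) auto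
  moreover have "finite {c \<in> M. a \<le> c \<and> c < b}"
    by (rule finite_subset[OF _ fin]) auto
  ultimately show ?thesis
    using False by (simp add: split)
qed

text \<open>The defining recursion says that \<^term>\<open>mobius M\<close> is a left inverse of the zeta function in the
  incidence algebra; here it is shown to be a right inverse too. Both ways of bracketing
  \<open>\<mu> \<zeta> \<mu>\<close> at \<open>(a, b)\<close> agree. One way gives \<open>\<mu>(a, b)\<close>. The other gives, by induction on the
  interval, the wanted sum plus \<open>\<mu>(a, b)\<close>.\<close>

lemma mobius_sum_left:
  assumes "a \<in> M" "b \<in> M" "a < b" "finite {c \<in> M. a \<le> c \<and> c \<le> b}"
  shows "(\<Sum>c | c \<in> M \<and> a \<le> c \<and> c \<le> b. mobius M c b) = 0"
  using assms
proof (induction "card {c \<in> M. a \<le> c \<and> c \<le> b}" arbitrary: a rule: less_induct)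
  case less
  define I where "I = {c \<in> M. a \<le> c \<and> c \<le> b}"
  define G where "G x = (\<Sum>c | c \<in> M \<and> x \<le> c \<and> c \<le> b. mobius M c b)" for x
  have fin: "finite I"
    using less.prems by (simp add: I_def)
  have Gb: "G b = 1"
  proof -
    have "{c \<in> M. b \<le> c \<and> c \<le> b} = {b}"
      using less.prems by auto
    then show ?thesis
      using less.prems by (simp add: G_def mobius_self)
  qed
  have G0: "G x = 0" if x: "x \<in> I - {a, b}" for x
  proof -
    have "{c \<in> M. x \<le> c \<and> c \<le> b} \<subseteq> I"
      using x by (auto simp: I_def)
    moreover have "a \<in> I - {c \<in> M. x \<le> c \<and> c \<le> b}"
      using x less.prems by (auto simp: I_def)
    ultimately have "{c \<in> M. x \<le> c \<and> c \<le> b} \<subset> I"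
      by blast
    then have "card {c \<in> M. x \<le> c \<and> c \<le> b} < card {c \<in> M. a \<le> c \<and> c \<le> b}"
      and "finite {c \<in> M. x \<le> c \<and> c \<le> b}"
      using fin by (auto simp: I_def intro: psubset_card_mono finite_subset)
    moreover have "x \<in> M" "x < b"
      using x by (auto simp: I_def order.strict_iff_order)
    ultimately show ?thesis
      using less.hyps less.prems(2) by (simp add: G_def)
  qed
  have "(\<Sum>x\<in>I. mobius M a x * G x)
      = (\<Sum>x\<in>I. \<Sum>c | c \<in> I \<and> x \<le> c. mobius M a x * mobius M c b)"
    by (rule sum.cong)
      (auto simp: I_def G_def sum_distrib_left intro!: sum.cong)
  also have "\<dots> = (\<Sum>c\<in>I. \<Sum>x | x \<in> I \<and> x \<le> c. mobius M a x * mobius M c b)"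
    by (rule sum.swap_restrict[OF fin fin])
  also have "\<dots> = (\<Sum>c\<in>I. (if a = c then 1 else 0) * mobius M c b)"
  proof (rule sum.cong[OF refl])
    fix c assume c: "c \<in> I"
    have "{x \<in> I. x \<le> c} = {x \<in> M. a \<le> x \<and> x \<le> c}"
      using c by (auto simp: I_def)
    moreover have "finite {x \<in> I. x \<le> c}"
      using fin by simp
    ultimately have "(\<Sum>x | x \<in> I \<and> x \<le> c. mobius M a x) = (if a = c then 1 else 0)"
      using mobius_sum_right[of a M c] c less.prems by (simp add: I_def)
    then show "(\<Sum>x | x \<in> I \<and> x \<le> c. mobius M a x * mobius M c b)
        = (if a = c then 1 else 0) * mobius M c b"
      by (simp flip: sum_distrib_right)
  qed
  also have "\<dots> = (\<Sum>c\<in>I. if c = a then mobius M c b else 0)"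
    by (rule sum.cong) auto
  also have "\<dots> = mobius M a b"
    using fin less.prems by (simp add: I_def less_imp_le)
  finally have "(\<Sum>x\<in>I. mobius M a x * G x) = mobius M a b" .
  moreover have "(\<Sum>x\<in>I. mobius M a x * G x) = (\<Sum>x\<in>{a, b}. mobius M a x * G x)"
    by (rule sum.mono_neutral_right) (use fin G0 less.prems in \<open>auto simp: I_def\<close>)
  ultimately have "G a = 0"
    using less.prems Gb by (auto simp: mobius_self)
  then show ?case
    by (simp add: G_def)
qed

text \<open>Moebius inversion: the elements \<^term>\<open>u_elem M y\<close> arise from the basis elements by the Moebius
  function, so summing them over a down-set of \<open>M\<close> undoes this. For \<open>M = ji\<close> they serve as the
  contributions of the single join-irreducibles.\<close>

lemma sum_u_elem:
  fixes M :: "'a::order set"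
  assumes "x \<in> M" and fin: "finite {b \<in> M. b \<le> x}"
  shows "(\<Sum>y | y \<in> M \<and> y \<le> x. u_elem M y) = frag_of x"
proof -
  define D where "D = {b \<in> M. b \<le> x}"
  have finD: "finite D"
    using fin by (simp add: D_def)
  have "(\<Sum>y\<in>D. u_elem M y)
      = (\<Sum>y\<in>D. \<Sum>b | b \<in> D \<and> b \<le> y. frag_cmul (mobius M b y) (frag_of b))"
    by (rule sum.cong) (auto simp: D_def u_elem_def intro!: sum.cong)
  also have "\<dots> = (\<Sum>b\<in>D. \<Sum>y | y \<in> D \<and> b \<le> y. frag_cmul (mobius M b y) (frag_of b))"
    by (rule sum.swap_restrict[OF finD finD])
  also have "\<dots> = (\<Sum>b\<in>D. if b = x then frag_of b else 0)"
  proof (rule sum.cong[OF refl])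
    fix b assume b: "b \<in> D"
    have "{y \<in> D. b \<le> y} = {y \<in> M. b \<le> y \<and> y \<le> x}"
      by (auto simp: D_def)
    moreover have "finite {y \<in> D. b \<le> y}"
      using finD by simp
    ultimately have "(\<Sum>y | y \<in> D \<and> b \<le> y. mobius M b y) = (if b = x then 1 else 0)"
      using mobius_sum_right[of b M x] b \<open>x \<in> M\<close> by (simp add: D_def)
    then show "(\<Sum>y | y \<in> D \<and> b \<le> y. frag_cmul (mobius M b y) (frag_of b))
        = (if b = x then frag_of b else 0)"
      by (simp flip: frag.scale_sum_left)
  qed
  also have "\<dots> = frag_of x"
    using finD \<open>x \<in> M\<close> by (simp add: D_def)
  finally show ?thesis
    by (simp add: D_def)
qed

section \<open>Join-irreducible elements\<close>

text \<open>Join-irreducibility is about arbitrary nonempty joins. When the down-set of \<open>x\<close> is finite, a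
  failing family is finite, and adding its members one at a time must reach \<open>x\<close> at some step, which
  is then a binary join.\<close>

lemma not_ji_obtain_sup:
  fixes x :: "'a::lattice"
  assumes fin: "finite {b. b \<le> x}" and "x \<notin> ji"
  obtains y z where "y < x" "z < x" "x = sup y z"
proof -
  obtain S where S: "S \<noteq> {}" "isLub UNIV S x" "x \<notin> S"
    using \<open>x \<notin> ji\<close> by (auto simp: ji_def join_irreducible_def)
  have le: "\<And>s. s \<in> S \<Longrightarrow> s \<le> x"
    and least: "\<And>u. (\<And>s. s \<in> S \<Longrightarrow> s \<le> u) \<Longrightarrow> x \<le> u"
    using S(2) by (auto simp: isLub_def leastP_def isUb_def setle_def setge_def)
  have "finite S"
    by (rule finite_subset[OF _ fin]) (use le in auto)
  have "\<exists>y z. y < x \<and> z < x \<and> x = sup y z"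
  proof (rule ccontr)
    assume no: "\<nexists>y z. y < x \<and> z < x \<and> x = sup y z"
    have "\<exists>u<x. \<forall>s\<in>S. s \<le> u"
      using \<open>finite S\<close> S(1) le S(3)
    proof (induction S rule: finite_ne_induct)
      case (singleton s)
      then show ?case
        by (auto simp: order.strict_iff_order)
    next
      case (insert s F)
      then obtain u where u: "u < x" "\<forall>t\<in>F. t \<le> u"
        by auto
      have "s < x"
        using insert.prems by (auto simp: order.strict_iff_order)
      then have "sup s u < x"
        using no u(1) by (metis less_imp_le order.not_eq_order_implies_strict sup_least)
      then show ?case
        using u(2) by (intro exI[of _ "sup s u"]) (auto intro: le_supI2)
    qed
    then show False
      using least by (metis leD)
  qed
  then show ?thesis
    using that by blast
qed

text \<open>Distributivity enters here: \<open>j \<le> sup y z\<close> makes \<open>j\<close> the join of \<open>inf j y\<close> and \<open>inf j z\<close>, so \<open>j\<close> is one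
  of the two.\<close>

lemma ji_join_prime:
  fixes j :: "'a::distrib_lattice"
  assumes "j \<in> ji"
  shows "j \<le> sup y z \<longleftrightarrow> j \<le> y \<or> j \<le> z"
proof
  assume "j \<le> sup y z"
  then have "j = sup (inf j y) (inf j z)"
    by (metis inf.absorb1 inf_sup_distrib1)
  then have "j \<le> u" if "inf j y \<le> u" "inf j z \<le> u" for u
    using that by (metis sup_least)
  then have "isLub UNIV {inf j y, inf j z} j"
    by (auto simp: isLub_def leastP_def isUb_def setle_def setge_def)
  then have "j \<in> {inf j y, inf j z}"
    by (intro assms[unfolded ji_def join_irreducible_def mem_Collect_eq, rule_format]) simp
  then show "j \<le> y \<or> j \<le> z"
    by (metis inf.orderI insertE singletonD)
qed (auto intro: le_supI1 le_supI2)

section \<open>Decomposition modulo the submodule of inclusion--exclusion relations\<close>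

text \<open>The induction is on the size of the down-set of \<open>x\<close>. Both \<open>frag_of\<close> (modulo \<^term>\<open>N_submodule\<close>) and
  the sum over the join-irreducibles below an element are valuations, so agreement at \<open>y\<close>, \<open>z\<close> and
  \<open>inf y z\<close> forces agreement at \<open>sup y z\<close>.\<close>

lemma frag_of_cong_sum_u_elem_ji:
  fixes x :: "'a::distrib_lattice"
  assumes lf: "lowly_finite TYPE('a)"
  shows "frag_of x - (\<Sum>j | j \<in> ji \<and> j \<le> x. u_elem ji j) \<in> N_submodule"
proof (induction "card {b. b \<le> x}" arbitrary: x rule: less_induct)
  case less
  define J where "J x = {j \<in> ji. j \<le> x}" for x :: 'a
  define S where "S x = (\<Sum>j\<in>J x. u_elem ji j)" for x :: 'a
  have fin: "finite {b. b \<le> x}" for x :: 'a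
    using lf by (simp add: lowly_finite_def)
  have finJ: "finite (J x)" for x
    by (rule finite_subset[OF _ fin[of x]]) (auto simp: J_def)
  have IH: "frag_of y - S y \<in> N_submodule" if "y < x" for y
  proof -
    have "{b. b \<le> y} \<subset> {b. b \<le> x}"
      using that by (auto simp: less_le_not_le dest: order_trans)
    then show ?thesis
      using less.hyps[of y] fin[of x] by (simp add: S_def J_def psubset_card_mono)
  qed
  show ?case
  proof (cases "x \<in> ji")
    case True
    then have "S x = frag_of x"
      using sum_u_elem[of x ji] finJ[of x] by (simp add: S_def J_def)
    then show ?thesis
      by (simp add: S_def J_def N_submodule_def frag.span_zero)
  next
    case False
    then obtain y z where yz: "y < x" "z < x" and x: "x = sup y z"
      using not_ji_obtain_sup[OF fin] by blast
    have "J x = J y \<union> J z" "J (inf y z) = J y \<inter> J z"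
      by (auto simp: x J_def ji_join_prime)
    then have S: "S x + S (inf y z) = S y + S z"
      using sum.union_inter[OF finJ[of y] finJ[of z], of "u_elem ji"] by (simp add: S_def)
    have inf: "inf y z < x"
      using yz by (meson inf_le1 le_less_trans)
    have rel: "frag_of (inf y z) + frag_of x - frag_of y - frag_of z \<in> N_submodule"
      unfolding N_submodule_def x by (rule frag.span_base) blast
    have "(frag_of (inf y z) + frag_of x - frag_of y - frag_of z)
        + ((frag_of y - S y) + (frag_of z - S z) - (frag_of (inf y z) - S (inf y z)))
        \<in> N_submodule"
      using rel IH[OF yz(1)] IH[OF yz(2)] IH[OF inf] unfolding N_submodule_def
      by (rule frag.span_add[OF _ frag.span_diff[OF frag.span_add]])
    also have "(frag_of (inf y z) + frag_of x - frag_of y - frag_of z)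
        + ((frag_of y - S y) + (frag_of z - S z) - (frag_of (inf y z) - S (inf y z)))
        = frag_of x - (S y + S z - S (inf y z))"
      by (simp add: algebra_simps)
    also have "\<dots> = frag_of x - S x"
      by (simp flip: S)
    finally show ?thesis
      by (simp add: S_def J_def)
  qed
qed

theorem theorem4p20:
  fixes M :: "'a::{distrib_lattice, bounded_lattice} set" and a :: 'a
  assumes "lowly_finite TYPE('a)"
    and "ji \<subseteq> M"
    and "a \<in> M - ji"
  shows "u_elem M a \<in> N_submodule"
proof -
  define B where "B = {b \<in> M. b \<le> a}"
  define J where "J = {j \<in> ji. j \<le> a}"
  define S where "S b = (\<Sum>j | j \<in> ji \<and> j \<le> b. u_elem ji j)" for b :: 'a
  have fin: "finite {b. b \<le> a}"
    using assms(1) by (simp add: lowly_finite_def)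
  have finB: "finite B"
    by (rule finite_subset[OF _ fin]) (auto simp: B_def)
  have finJ: "finite J"
    by (rule finite_subset[OF _ fin]) (auto simp: J_def)
  have "(\<Sum>b\<in>B. frag_cmul (mobius M b a) (frag_of b - S b)) \<in> N_submodule"
    using frag_of_cong_sum_u_elem_ji[OF assms(1)] unfolding N_submodule_def S_def
    by (intro frag.span_sum frag.span_scale)
  also have "(\<Sum>b\<in>B. frag_cmul (mobius M b a) (frag_of b - S b))
      = u_elem M a - (\<Sum>b\<in>B. frag_cmul (mobius M b a) (S b))"
    by (simp add: u_elem_def B_def frag.scale_right_diff_distrib sum_subtractf)
  also have "(\<Sum>b\<in>B. frag_cmul (mobius M b a) (S b)) = 0"
  proof -
    have "(\<Sum>b\<in>B. frag_cmul (mobius M b a) (S b))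
        = (\<Sum>b\<in>B. \<Sum>j | j \<in> J \<and> j \<le> b. frag_cmul (mobius M b a) (u_elem ji j))"
      by (rule sum.cong)
        (auto simp: B_def J_def S_def frag.scale_sum_right intro!: sum.cong)
    also have "\<dots> = (\<Sum>j\<in>J. \<Sum>b | b \<in> B \<and> j \<le> b. frag_cmul (mobius M b a) (u_elem ji j))"
      by (rule sum.swap_restrict[OF finB finJ])
    also have "\<dots> = 0"
    proof (rule sum.neutral, intro ballI)
      fix j assume j: "j \<in> J"
      have "{b \<in> B. j \<le> b} = {b \<in> M. j \<le> b \<and> b \<le> a}"
        by (auto simp: B_def)
      moreover have "finite {b \<in> B. j \<le> b}"
        using finB by simp
      moreover have "j \<in> M" "j < a"
        using j assms(2,3) by (auto simp: J_def order.strict_iff_order)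
      ultimately have "(\<Sum>b | b \<in> B \<and> j \<le> b. mobius M b a) = 0"
        using mobius_sum_left[of j M a] assms(3) by simp
      then show "(\<Sum>b | b \<in> B \<and> j \<le> b. frag_cmul (mobius M b a) (u_elem ji j)) = 0"
        by (simp flip: frag.scale_sum_left)
    qed
    finally show ?thesis .
  qed
  finally show ?thesis
    by simp
qed

end
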